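(* Let $\mathscr G$ be an ample groupoid and $\mu$ an invariant measure on $\mathscr G^{(0)}$. Then $\tau\colon\mathbb C\mathscr G\to\mathbb C$ given by \[\tau(f)=\int f|_{\mathscr G^{(0)}}\,d\mu\] is a $\Gamma_c(\mathscr G)$-contractive trace. Moreover, if $\mathscr G^{(0)}$ is compact and $\mu$ is normalized (that is, $\mu(\mathscr G^{(0)})=1$), then $\tau$ is normalized.
   Context: A groupoid $\mathscr G$ is identified with its set of arrows, objects being identified with identity arrows; $\mathscr G^{(0)}$ is the unit space, $\boldsymbol d(\gamma)=\gamma^{-1}\gamma$, $\boldsymbol r(\gamma)=\gamma\gamma^{-1}$. A topological groupoid is étale if $\boldsymbol d$ is a local homeomorphism. An ample groupoid is an étale groupoid whose unit space is Hausdorff with a basis of compact open sets ($\mathscr G$ itself need not be Hausdorff). A bisection is an open subset $U\subseteq\mathscr G$ on which $\boldsymbol d$ and $\boldsymbol r$ are injective; $\Gamma(\mathscr G)$ (resp. $\Gamma_c(\mathscr G)$) is the set of open (resp. compact open) bisections, with setwise product and inverse. $\mathbb C\mathscr G$ is the span, inside the functions $\mathscr G\to\mathbb C$, of the indicator functions $1_U$, $U\in\Gamma_c(\mathscr G)$, with convolution product $(f\ast g)(\gamma)=\sum_{\alpha\beta=\gamma}f(\alpha)g(\beta)$ and involution $f^\ast(\gamma)=\overline{f(\gamma^{-1})}$; it is unital (with identity $1_{\mathscr G^{(0)}}$) when $\mathscr G^{(0)}$ is compact. An invariant measure on $\mathscr G^{(0)}$ is a (not necessarily finite) Radon measure $\mu$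 on $\mathscr G^{(0)}$ with $\mu(U^{-1}U)=\mu(UU^{-1})$ for all $U\in\Gamma(\mathscr G)$. A trace on a complex $\ast$-algebra $A$ is a linear functional $\tau\colon A\to\mathbb C$ with $\tau(ab)=\tau(ba)$, $\tau(a^\ast)=\overline{\tau(a)}$ and $\tau(aa^\ast)\geq 0$ for all $a,b\in A$; for unital $A$ it is normalized if $\tau(1)=1$. A trace $\tau$ on $\mathbb C\mathscr G$ is $\Gamma_c(\mathscr G)$-contractive if $\tau((f\ast 1_U)\ast(f\ast 1_U)^\ast)\leq\tau(f\ast f^\ast)$ for all $f\in\mathbb C\mathscr G$ and $U\in\Gamma_c(\mathscr G)$. *)

theory Defs
  imports "HOL-Analysis.Analysis"
begin

section \<open>Ample groupoids\<close>

text \<open>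
  A groupoid is given by its arrows alone: they form the \<open>topspace\<close> of a topology, \<open>comp_pairs\<close> is
  the set of composable pairs, and \<open>gmult\<close> and \<open>ginv\<close> are only meaningful on \<open>comp_pairs\<close> and on the
  arrows, respectively.  Objects are the identity arrows.
\<close>

record 'a groupoid_data =
  gtop :: "'a topology"
  comp_pairs :: "('a \<times> 'a) set"
  gmult :: "'a \<Rightarrow> 'a \<Rightarrow> 'a"
  ginv :: "'a \<Rightarrow> 'a"

definition arrows :: "'a groupoid_data \<Rightarrow> 'a set" where
  "arrows G = topspace (gtop G)"

definition dom_map :: "'a groupoid_data \<Rightarrow> 'a \<Rightarrow> 'a" where
  "dom_map G \<gamma> = gmult G (ginv G \<gamma>) \<gamma>"

definition ran_map :: "'a groupoid_data \<Rightarrow> 'a \<Rightarrow> 'a" where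
  "ran_map G \<gamma> = gmult G \<gamma> (ginv G \<gamma>)"

definition units :: "'a groupoid_data \<Rightarrow> 'a set" where
  "units G = dom_map G ` arrows G"

definition unit_space :: "'a groupoid_data \<Rightarrow> 'a topology" where
  "unit_space G = subtopology (gtop G) (units G)"

text \<open>
  Hahn's axioms for a groupoid presented by its arrows.  They imply that \<open>(a, b)\<close> is composable if
  and only if \<open>dom_map G a = ran_map G b\<close>, and that \<open>units G\<close> is also the image of \<open>ran_map G\<close>.
\<close>

locale groupoid =
  fixes G :: "'a groupoid_data"
  assumes comp_pairs_subset: "comp_pairs G \<subseteq> arrows G \<times> arrows G"
    and mult_closed: "(a, b) \<in> comp_pairs G \<Longrightarrow> gmult G a b \<in> arrows G"
    and inv_closed: "a \<in> arrows G \<Longrightarrow> ginv G a \<in> arrows G"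
    and inv_inv: "a \<in> arrows G \<Longrightarrow> ginv G (ginv G a) = a"
    and comp_left: "\<lbrakk>(a, b) \<in> comp_pairs G; (b, c) \<in> comp_pairs G\<rbrakk>
          \<Longrightarrow> (gmult G a b, c) \<in> comp_pairs G"
    and comp_right: "\<lbrakk>(a, b) \<in> comp_pairs G; (b, c) \<in> comp_pairs G\<rbrakk>
          \<Longrightarrow> (a, gmult G b c) \<in> comp_pairs G"
    and mult_assoc: "\<lbrakk>(a, b) \<in> comp_pairs G; (b, c) \<in> comp_pairs G\<rbrakk>
          \<Longrightarrow> gmult G (gmult G a b) c = gmult G a (gmult G b c)"
    and comp_inv: "a \<in> arrows G \<Longrightarrow> (a, ginv G a) \<in> comp_pairs G"
    and inv_cancel_left: "(a, b) \<in> comp_pairs G \<Longrightarrow> gmult G (ginv G a) (gmult G a b) = b"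
    and inv_cancel_right: "(a, b) \<in> comp_pairs G \<Longrightarrow> gmult G (gmult G a b) (ginv G b) = a"

locale topological_groupoid = groupoid +
  assumes continuous_mult:
      "continuous_map (subtopology (prod_topology (gtop G) (gtop G)) (comp_pairs G)) (gtop G)
         (\<lambda>(a, b). gmult G a b)"
    and continuous_inv: "continuous_map (gtop G) (gtop G) (ginv G)"

definition local_homeomorphism :: "'a topology \<Rightarrow> 'b topology \<Rightarrow> ('a \<Rightarrow> 'b) \<Rightarrow> bool" where
  "local_homeomorphism X Y f \<longleftrightarrow>
     f \<in> topspace X \<rightarrow> topspace Y \<and>
     (\<forall>x \<in> topspace X. \<exists>U. openin X U \<and> x \<in> U \<and> openin Y (f ` U) \<and>
        homeomorphic_map (subtopology X U) (subtopology Y (f ` U)) f)"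

locale etale_groupoid = topological_groupoid +
  assumes local_homeomorphism_dom: "local_homeomorphism (gtop G) (unit_space G) (dom_map G)"

locale ample_groupoid = etale_groupoid +
  assumes Hausdorff_units: "Hausdorff_space (unit_space G)"
    and compact_open_basis_units:
      "openin (unit_space G) =
         arbitrary union_of (\<lambda>K. openin (unit_space G) K \<and> compactin (unit_space G) K)"

definition set_mult :: "'a groupoid_data \<Rightarrow> 'a set \<Rightarrow> 'a set \<Rightarrow> 'a set" where
  "set_mult G U V = {gmult G a b | a b. a \<in> U \<and> b \<in> V \<and> (a, b) \<in> comp_pairs G}"

definition set_inv :: "'a groupoid_data \<Rightarrow> 'a set \<Rightarrow> 'a set" where
  "set_inv G U = ginv G ` U"

definition bisections :: "'a groupoid_data \<Rightarrow> 'a set set" where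
  "bisections G = {U. openin (gtop G) U \<and> inj_on (dom_map G) U \<and> inj_on (ran_map G) U}"

definition compact_bisections :: "'a groupoid_data \<Rightarrow> 'a set set" where
  "compact_bisections G = {U \<in> bisections G. compactin (gtop G) U}"


section \<open>Traces on complex star-algebras\<close>

text \<open>The record carries the operations of a complex star-algebra on an explicit carrier.\<close>

record 'b star_alg =
  alg_carrier :: "'b set"
  alg_add :: "'b \<Rightarrow> 'b \<Rightarrow> 'b"
  alg_scale :: "complex \<Rightarrow> 'b \<Rightarrow> 'b"
  alg_mult :: "'b \<Rightarrow> 'b \<Rightarrow> 'b"
  alg_star :: "'b \<Rightarrow> 'b"

text \<open>
  The order on \<^typ>\<open>complex\<close> is the one of \<^theory>\<open>HOL-Library.Complex_Order\<close>, so \<open>0 \<le> z\<close>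
  says that \<open>z\<close> is real and nonnegative.
\<close>

definition is_trace :: "'b star_alg \<Rightarrow> ('b \<Rightarrow> complex) \<Rightarrow> bool" where
  "is_trace A \<tau> \<longleftrightarrow>
     (\<forall>a \<in> alg_carrier A. \<forall>b \<in> alg_carrier A. \<tau> (alg_add A a b) = \<tau> a + \<tau> b) \<and>
     (\<forall>c. \<forall>a \<in> alg_carrier A. \<tau> (alg_scale A c a) = c * \<tau> a) \<and>
     (\<forall>a \<in> alg_carrier A. \<forall>b \<in> alg_carrier A. \<tau> (alg_mult A a b) = \<tau> (alg_mult A b a)) \<and>
     (\<forall>a \<in> alg_carrier A. \<tau> (alg_star A a) = cnj (\<tau> a)) \<and>
     (\<forall>a \<in> alg_carrier A. 0 \<le> \<tau> (alg_mult A a (alg_star A a)))"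

definition is_identity :: "'b star_alg \<Rightarrow> 'b \<Rightarrow> bool" where
  "is_identity A e \<longleftrightarrow>
     e \<in> alg_carrier A \<and> (\<forall>a \<in> alg_carrier A. alg_mult A e a = a \<and> alg_mult A a e = a)"

definition is_normalized_trace :: "'b star_alg \<Rightarrow> ('b \<Rightarrow> complex) \<Rightarrow> bool" where
  "is_normalized_trace A \<tau> \<longleftrightarrow> is_trace A \<tau> \<and> (\<exists>e. is_identity A e \<and> \<tau> e = 1)"


section \<open>The algebra of an ample groupoid\<close>

text \<open>
  Functions on the groupoid are represented by functions on the whole type that vanish outside
  \<open>arrows G\<close>.
\<close>

definition groupoid_functions :: "'a groupoid_data \<Rightarrow> ('a \<Rightarrow> complex) set" where
  "groupoid_functions G =
     {f. \<exists>\<F> c. finite \<F> \<and> \<F> \<subseteq> compact_bisections G \<and>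
          f = (\<lambda>\<gamma>. \<Sum>U\<in>\<F>. c U * indicator U \<gamma>)}"

text \<open>
  The sum has only finitely many nonzero terms when \<open>f\<close> and \<open>g\<close> lie in \<open>groupoid_functions G\<close>.
\<close>

definition convolution ::
    "'a groupoid_data \<Rightarrow> ('a \<Rightarrow> complex) \<Rightarrow> ('a \<Rightarrow> complex) \<Rightarrow> ('a \<Rightarrow> complex)" where
  "convolution G f g =
     (\<lambda>\<gamma>. \<Sum>\<^sub>\<infinity>(\<alpha>, \<beta>) \<in> {(\<alpha>, \<beta>) \<in> comp_pairs G. gmult G \<alpha> \<beta> = \<gamma>}. f \<alpha> * g \<beta>)"

definition involution :: "'a groupoid_data \<Rightarrow> ('a \<Rightarrow> complex) \<Rightarrow> ('a \<Rightarrow> complex)" where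
  "involution G f = (\<lambda>\<gamma>. if \<gamma> \<in> arrows G then cnj (f (ginv G \<gamma>)) else 0)"

definition groupoid_algebra :: "'a groupoid_data \<Rightarrow> ('a \<Rightarrow> complex) star_alg" where
  "groupoid_algebra G =
     \<lparr> alg_carrier = groupoid_functions G,
       alg_add = (\<lambda>f g \<gamma>. f \<gamma> + g \<gamma>),
       alg_scale = (\<lambda>c f \<gamma>. c * f \<gamma>),
       alg_mult = convolution G,
       alg_star = involution G \<rparr>"

definition is_contractive_trace :: "'a groupoid_data \<Rightarrow> (('a \<Rightarrow> complex) \<Rightarrow> complex) \<Rightarrow> bool" where
  "is_contractive_trace G \<tau> \<longleftrightarrow>
     is_trace (groupoid_algebra G) \<tau> \<and>
     (\<forall>f \<in> groupoid_functions G. \<forall>U \<in> compact_bisections G.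
        \<tau> (convolution G (convolution G f (indicator U))
                         (involution G (convolution G f (indicator U))))
          \<le> \<tau> (convolution G f (involution G f)))"


section \<open>Invariant measures\<close>

definition borel_of :: "'a topology \<Rightarrow> 'a measure" where
  "borel_of X = sigma (topspace X) {U. openin X U}"

text \<open>
  Radon measures on a locally compact Hausdorff space, in the sense of Folland: Borel measures that
  are finite on compact sets, outer regular on Borel sets and inner regular on open sets.
\<close>

definition radon_measure :: "'a topology \<Rightarrow> 'a measure \<Rightarrow> bool" where
  "radon_measure X \<mu> \<longleftrightarrow>
     sets \<mu> = sets (borel_of X) \<and>
     (\<forall>K. compactin X K \<longrightarrow> emeasure \<mu> K < \<infinity>) \<and>
     (\<forall>B \<in> sets \<mu>. emeasure \<mu> B = (INF U \<in> {U. openin X U \<and> B \<subseteq> U}. emeasure \<mu> U)) \<and>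
     (\<forall>U. openin X U \<longrightarrow> emeasure \<mu> U = (SUP K \<in> {K. compactin X K \<and> K \<subseteq> U}. emeasure \<mu> K))"

definition invariant_measure :: "'a groupoid_data \<Rightarrow> 'a measure \<Rightarrow> bool" where
  "invariant_measure G \<mu> \<longleftrightarrow>
     radon_measure (unit_space G) \<mu> \<and>
     (\<forall>U \<in> bisections G.
        emeasure \<mu> (set_mult G (set_inv G U) U) = emeasure \<mu> (set_mult G U (set_inv G U)))"

text \<open>
  Since \<open>space \<mu> = units G\<close>, the integral only involves the restriction of \<open>f\<close> to the unit space.
\<close>

definition measure_functional :: "'a measure \<Rightarrow> ('a \<Rightarrow> complex) \<Rightarrow> complex" where
  "measure_functional \<mu> f = (\<integral>x. f x \<partial>\<mu>)"

end

theory Submission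
  imports Defs
begin

text \<open>
  At a unit \<open>x\<close> the convolution \<open>f * g\<close> is the sum of \<open>f \<alpha> \<cdot> g (\<alpha>\<inverse>)\<close> over the arrows \<open>\<alpha>\<close> with range \<open>x\<close>.
  Hence \<open>1\<^sub>U * 1\<^sub>V\<close> restricts on the units to the indicator of the range of \<open>W = U \<inter> V\<inverse>\<close>, while
  \<open>1\<^sub>V * 1\<^sub>U\<close> restricts to that of the source of \<open>W\<close>; invariance of the measure gives the trace
  property.  Moreover \<open>f * f\<^sup>*\<close> at \<open>x\<close> is the sum of \<open>\<bar>f \<alpha>\<bar>\<^sup>2\<close> over the fibre, and passing from \<open>f\<close> to
  \<open>f * 1\<^sub>U\<close> reindexes part of this sum and drops the rest.
\<close>

section \<open>Sources, ranges, units and bisections in a groupoid\<close>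

context groupoid
begin

lemma comp_inv_left: "a \<in> arrows G \<Longrightarrow> (ginv G a, a) \<in> comp_pairs G"
  by (metis comp_inv inv_closed inv_inv)

lemma dom_closed: "a \<in> arrows G \<Longrightarrow> dom_map G a \<in> arrows G"
  unfolding dom_map_def by (intro mult_closed comp_inv_left)

lemma comp_arrows:
  assumes "(a, b) \<in> comp_pairs G"
  shows "a \<in> arrows G" "b \<in> arrows G"
  using assms comp_pairs_subset by auto

lemma dom_inv: "a \<in> arrows G \<Longrightarrow> dom_map G (ginv G a) = ran_map G a"
  by (simp add: dom_map_def ran_map_def inv_inv)

lemma ran_inv: "a \<in> arrows G \<Longrightarrow> ran_map G (ginv G a) = dom_map G a"
  by (simp add: dom_map_def ran_map_def inv_inv)

lemma mult_dom: "a \<in> arrows G \<Longrightarrow> gmult G a (dom_map G a) = a"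
  unfolding dom_map_def
  by (metis comp_inv comp_inv_left inv_cancel_right inv_inv mult_assoc)

lemma ran_mult: "a \<in> arrows G \<Longrightarrow> gmult G (ran_map G a) a = a"
  unfolding ran_map_def by (metis comp_inv inv_cancel_right inv_inv)

text \<open>The source of \<open>a\<close> acts on \<open>b\<close> as a left identity, because
  \<open>b\<close> is recovered by cancelling \<open>a\<close> in \<open>gmult G a b\<close>.
  Cancelling \<open>b\<close> on the right then turns that source into the range of
  \<open>b\<close>.\<close>

lemma dom_eq_ran:
  assumes "(a, b) \<in> comp_pairs G"
  shows "dom_map G a = ran_map G b"
proof -
  have a: "(ginv G a, a) \<in> comp_pairs G" and b: "(b, ginv G b) \<in> comp_pairs G"
    using comp_inv_left comp_inv comp_arrows[OF assms] by auto
  have c: "(dom_map G a, b) \<in> comp_pairs G"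
    unfolding dom_map_def by (rule comp_left[OF a assms])
  have "gmult G (dom_map G a) b = b"
    unfolding dom_map_def using mult_assoc[OF a assms] inv_cancel_left[OF assms] by simp
  then show ?thesis
    using inv_cancel_right[OF c] by (simp add: ran_map_def)
qed

text \<open>For the converse, the common unit serves as a middle factor: \<open>a\<close> composes
  with its source and the range of \<open>b\<close> composes with \<open>b\<close>, so
  \<open>comp_right\<close> makes \<open>a\<close> composable with the product of that unit and
  \<open>b\<close>, which is \<open>b\<close>.\<close>

lemma comp_pairs_iff:
  "(a, b) \<in> comp_pairs G \<longleftrightarrow> a \<in> arrows G \<and> b \<in> arrows G \<and> dom_map G a = ran_map G b"
proof (intro iffI conjI; (elim conjE)?)
  assume ab: "a \<in> arrows G" "b \<in> arrows G" "dom_map G a = ran_map G b"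
  have "(a, dom_map G a) \<in> comp_pairs G"
    unfolding dom_map_def using comp_inv comp_inv_left comp_right ab by blast
  moreover have "(ran_map G b, b) \<in> comp_pairs G"
    unfolding ran_map_def using comp_inv comp_inv_left comp_left ab by blast
  ultimately show "(a, b) \<in> comp_pairs G"
    using comp_right ab ran_mult by metis
qed (auto dest: comp_arrows dom_eq_ran)

text \<open>The product still composes with \<open>ginv G b\<close>, so its source is the range of
  \<open>ginv G b\<close>.\<close>

lemma dom_mult:
  assumes "(a, b) \<in> comp_pairs G"
  shows "dom_map G (gmult G a b) = dom_map G b"
proof -
  have "(gmult G a b, ginv G b) \<in> comp_pairs G"
    using comp_left[OF assms comp_inv] comp_arrows[OF assms] by blast
  then show ?thesis
    using dom_eq_ran ran_inv comp_arrows[OF assms] by metis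
qed

lemma ran_comp:
  assumes "(a, b) \<in> comp_pairs G"
  shows "ran_map G (gmult G a b) = ran_map G a"
proof -
  have "(ginv G a, gmult G a b) \<in> comp_pairs G"
    using comp_right[OF comp_inv_left assms] comp_arrows[OF assms] by blast
  then show ?thesis
    using dom_eq_ran dom_inv comp_arrows[OF assms] by metis
qed

lemma dom_dom: "a \<in> arrows G \<Longrightarrow> dom_map G (dom_map G a) = dom_map G a"
  using dom_mult[OF comp_inv_left] by (simp add: dom_map_def)

lemma ran_dom: "a \<in> arrows G \<Longrightarrow> ran_map G (dom_map G a) = dom_map G a"
  using ran_comp[OF comp_inv_left] ran_inv by (simp add: dom_map_def)

lemma units_subset: "units G \<subseteq> arrows G"
  by (auto simp: units_def dom_closed)

lemma unit_dom: "x \<in> units G \<Longrightarrow> dom_map G x = x"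
  by (auto simp: units_def dom_dom)

lemma unit_ran: "x \<in> units G \<Longrightarrow> ran_map G x = x"
  by (auto simp: units_def ran_dom)

text \<open>Multiplying \<open>ginv G x\<close> on the right by its own source does not change it.
  That source is the range of \<open>x\<close>, hence \<open>x\<close> itself, so the product is
  also \<open>dom_map G x\<close>.\<close>

lemma unit_inv:
  assumes "x \<in> units G"
  shows "ginv G x = x"
proof -
  have x: "x \<in> arrows G"
    using assms units_subset by auto
  have "ginv G x = gmult G (ginv G x) (dom_map G (ginv G x))"
    using mult_dom inv_closed x by simp
  also have "\<dots> = dom_map G x"
    using assms x by (simp add: dom_inv unit_ran) (simp add: dom_map_def)
  finally show ?thesis
    using assms by (simp add: unit_dom)
qed

lemma dom_in_units: "a \<in> arrows G \<Longrightarrow> dom_map G a \<in> units G"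
  by (simp add: units_def)

lemma ran_in_units: "a \<in> arrows G \<Longrightarrow> ran_map G a \<in> units G"
  by (metis dom_inv dom_in_units inv_closed)

lemma topspace_unit_space: "topspace (unit_space G) = units G"
  using units_subset by (auto simp: unit_space_def arrows_def)

lemma bisection_subset: "U \<in> bisections G \<Longrightarrow> U \<subseteq> arrows G"
  by (simp add: bisections_def arrows_def openin_subset)

lemma set_inv_vimage:
  assumes "U \<subseteq> arrows G"
  shows "set_inv G U = {a \<in> arrows G. ginv G a \<in> U}"
  using assms inv_closed inv_inv by (force simp: set_inv_def)

lemma dom_set_inv: "U \<subseteq> arrows G \<Longrightarrow> dom_map G ` set_inv G U = ran_map G ` U"
  by (force simp: set_inv_def dom_inv image_image)

lemma ran_set_inv: "U \<subseteq> arrows G \<Longrightarrow> ran_map G ` set_inv G U = dom_map G ` U"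
  by (force simp: set_inv_def ran_inv image_image)

lemma set_inv_set_inv: "U \<subseteq> arrows G \<Longrightarrow> set_inv G (set_inv G U) = U"
  by (force simp: set_inv_def image_image inv_inv)

lemma inj_on_set_inv:
  assumes "U \<subseteq> arrows G"
  shows "inj_on (dom_map G) (set_inv G U) \<longleftrightarrow> inj_on (ran_map G) U"
    and "inj_on (ran_map G) (set_inv G U) \<longleftrightarrow> inj_on (dom_map G) U"
proof -
  have inj: "inj_on (ginv G) U"
    using assms by (intro inj_on_inverseI[of _ "ginv G"]) (auto simp: inv_inv)
  show "inj_on (dom_map G) (set_inv G U) \<longleftrightarrow> inj_on (ran_map G) U"
    unfolding set_inv_def comp_inj_on_iff[OF inj]
    using assms by (intro inj_on_cong) (auto simp: dom_inv)
  show "inj_on (ran_map G) (set_inv G U) \<longleftrightarrow> inj_on (dom_map G) U"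
    unfolding set_inv_def comp_inj_on_iff[OF inj]
    using assms by (intro inj_on_cong) (auto simp: ran_inv)
qed

text \<open>If \<open>a\<close> composes with \<open>ginv G b\<close>, then \<open>a\<close> and
  \<open>b\<close> have the same source and so coincide in \<open>W\<close>. Only the products of an
  element with its own inverse remain. This translates the sets in the invariance condition into
  ranges and, in the next lemma, sources.\<close>

lemma bisection_mult_inv:
  assumes "W \<in> bisections G"
  shows "set_mult G W (set_inv G W) = ran_map G ` W"
proof -
  have W: "W \<subseteq> arrows G" "inj_on (dom_map G) W"
    using assms bisection_subset by (auto simp: bisections_def)
  have "a = b" if "a \<in> W" "b \<in> W" "(a, ginv G b) \<in> comp_pairs G" for a b
    using that W dom_eq_ran[OF that(3)] ran_inv[of b] by (metis inj_onD subsetD)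
  moreover have "(a, ginv G a) \<in> comp_pairs G" if "a \<in> W" for a
    using that W comp_inv by blast
  ultimately show ?thesis
    unfolding set_mult_def set_inv_def ran_map_def image_def by blast
qed

lemma bisection_inv_mult:
  assumes "W \<in> bisections G"
  shows "set_mult G (set_inv G W) W = dom_map G ` W"
proof -
  have W: "W \<subseteq> arrows G" "inj_on (ran_map G) W"
    using assms bisection_subset by (auto simp: bisections_def)
  have "a = b" if "a \<in> W" "b \<in> W" "(ginv G a, b) \<in> comp_pairs G" for a b
    using that W dom_eq_ran[OF that(3)] dom_inv[of a] by (metis inj_onD subsetD)
  moreover have "(ginv G a, a) \<in> comp_pairs G" if "a \<in> W" for a
    using that W comp_inv_left by blast
  ultimately show ?thesis
    unfolding set_mult_def set_inv_def dom_map_def image_def by blast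
qed

end

section \<open>Continuity of source and range, and their openness in the etale case\<close>

context topological_groupoid
begin

lemma continuous_ran: "continuous_map (gtop G) (gtop G) (ran_map G)"
proof -
  have "continuous_map (gtop G) (subtopology (prod_topology (gtop G) (gtop G)) (comp_pairs G))
          (\<lambda>a. (a, ginv G a))"
    using comp_inv continuous_inv
    by (intro continuous_map_into_subtopology continuous_map_pairedI) (auto simp: arrows_def)
  from continuous_map_compose[OF this continuous_mult] show ?thesis
    by (simp add: o_def ran_map_def[abs_def])
qed

lemma continuous_dom: "continuous_map (gtop G) (gtop G) (dom_map G)"
  using continuous_map_compose[OF continuous_inv continuous_ran]
  by (rule continuous_map_eq) (simp add: ran_inv arrows_def)

lemma openin_set_inv:
  assumes "openin (gtop G) U"
  shows "openin (gtop G) (set_inv G U)"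
proof -
  have "U \<subseteq> arrows G"
    using assms by (simp add: arrows_def openin_subset)
  then show ?thesis
    using openin_continuous_map_preimage[OF continuous_inv assms]
    by (simp add: set_inv_vimage arrows_def)
qed

lemma set_inv_bisections: "U \<in> bisections G \<Longrightarrow> set_inv G U \<in> bisections G"
  using bisection_subset[of U] by (auto simp: bisections_def openin_set_inv inj_on_set_inv)

lemma set_inv_compact_bisections:
  "U \<in> compact_bisections G \<Longrightarrow> set_inv G U \<in> compact_bisections G"
  using image_compactin[OF _ continuous_inv]
  by (auto simp: compact_bisections_def set_inv_bisections) (simp add: set_inv_def)

lemma bisections_Int: "U \<in> bisections G \<Longrightarrow> V \<in> bisections G \<Longrightarrow> U \<inter> V \<in> bisections G"
  by (auto simp: bisections_def inj_on_Int)

text \<open>Since a Radon measure is finite on compact sets, this is the source of every finiteness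
  bound in the integrals below.\<close>

lemma compact_ran:
  assumes "U \<in> compact_bisections G"
  shows "compactin (unit_space G) (ran_map G ` U)"
proof -
  have "U \<subseteq> arrows G" "compactin (gtop G) U"
    using assms bisection_subset by (auto simp: compact_bisections_def)
  then show ?thesis
    using image_compactin[OF _ continuous_ran] ran_in_units
    by (auto simp: unit_space_def compactin_subtopology)
qed

end

context etale_groupoid
begin

text \<open>Around each point of \<open>W\<close> the source map restricts to a homeomorphism of
  some open \<open>U\<close> onto an open set of units, so the image of \<open>W \<inter> U\<close>
  is an open neighbourhood inside the image of \<open>W\<close>.\<close>

lemma openin_dom:
  assumes "openin (gtop G) W"
  shows "openin (unit_space G) (dom_map G ` W)"
proof (subst openin_subopen, intro ballI)
  fix y assume "y \<in> dom_map G ` W"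
  then obtain w where w: "w \<in> W" "y = dom_map G w" by auto
  then have "w \<in> topspace (gtop G)"
    using assms openin_subset by blast
  then obtain U where U: "openin (gtop G) U" "w \<in> U" "openin (unit_space G) (dom_map G ` U)"
    "homeomorphic_map (subtopology (gtop G) U) (subtopology (unit_space G) (dom_map G ` U)) (dom_map G)"
    using local_homeomorphism_dom unfolding local_homeomorphism_def by blast
  have "openin (subtopology (gtop G) U) (W \<inter> U)"
    using U(1) assms by (simp add: openin_open_subtopology openin_Int)
  with homeomorphic_imp_open_map[OF U(4)]
  have "openin (subtopology (unit_space G) (dom_map G ` U)) (dom_map G ` (W \<inter> U))"
    by (simp add: open_map_def)
  then have "openin (unit_space G) (dom_map G ` (W \<inter> U))"
    using U(3) by (simp add: openin_open_subtopology)
  then show "\<exists>T. openin (unit_space G) T \<and> y \<in> T \<and> T \<subseteq> dom_map G ` W"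
    using w U(2) by blast
qed

lemma openin_ran:
  assumes "openin (gtop G) W"
  shows "openin (unit_space G) (ran_map G ` W)"
  using openin_dom[OF openin_set_inv[OF assms]] assms
  by (simp add: dom_set_inv arrows_def openin_subset)

text \<open>Near a unit \<open>x\<close>, both \<open>\<gamma>\<close> and \<open>dom_map G \<gamma>\<close> lie in an open set on which \<open>dom_map G\<close> is
  injective, and \<open>dom_map G\<close> sends them to the same point.\<close>

lemma openin_units: "openin (gtop G) (units G)"
proof (subst openin_subopen, intro ballI)
  fix x assume x: "x \<in> units G"
  then have "x \<in> topspace (gtop G)"
    using units_subset by (auto simp: arrows_def)
  then obtain U where U: "openin (gtop G) U" "x \<in> U"
    "homeomorphic_map (subtopology (gtop G) U) (subtopology (unit_space G) (dom_map G ` U)) (dom_map G)"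
    using local_homeomorphism_dom unfolding local_homeomorphism_def by blast
  have UA: "U \<subseteq> arrows G"
    using U(1) by (simp add: arrows_def openin_subset)
  have inj: "inj_on (dom_map G) U"
    using homeomorphic_imp_injective_map[OF U(3)] UA by (simp add: arrows_def Int_absorb1)
  let ?V = "{a \<in> U. dom_map G a \<in> U}"
  have "openin (gtop G) ?V"
    by (rule openin_continuous_map_preimage_gen[OF continuous_dom U(1) U(1)])
  moreover have "?V \<subseteq> units G"
  proof safe
    fix a assume a: "a \<in> U" "dom_map G a \<in> U"
    then have "dom_map G a = a"
      using UA inj dom_dom by (auto dest: inj_onD)
    then show "a \<in> units G"
      using a(1) UA dom_in_units by (metis subsetD)
  qed
  ultimately show "\<exists>T. openin (gtop G) T \<and> x \<in> T \<and> T \<subseteq> units G"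
    using x U(2) unit_dom by (intro exI[of _ ?V]) auto
qed

lemma units_bisection: "units G \<in> bisections G"
  by (auto simp: bisections_def openin_units unit_dom unit_ran intro!: inj_onI)

end

section \<open>Convolution at units as a sum over range fibres\<close>

lemma has_sum_finite_sum:
  fixes f :: "'i \<Rightarrow> 'a \<Rightarrow> 'b::topological_comm_monoid_add"
  assumes "finite I" "\<And>i. i \<in> I \<Longrightarrow> (f i has_sum s i) A"
  shows "((\<lambda>x. \<Sum>i\<in>I. f i x) has_sum (\<Sum>i\<in>I. s i)) A"
  using assms by (induction I rule: finite_induct) (auto intro: has_sum_add)

context groupoid
begin

abbreviation ran_fibre :: "'a \<Rightarrow> 'a set" where
  "ran_fibre x \<equiv> {\<alpha> \<in> arrows G. ran_map G \<alpha> = x}"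

lemma compact_bisectionD:
  assumes "U \<in> compact_bisections G"
  shows "U \<in> bisections G" "U \<subseteq> arrows G" "openin (gtop G) U"
    "inj_on (ran_map G) U" "inj_on (dom_map G) U"
  using assms bisection_subset by (auto simp: compact_bisections_def bisections_def)

lemma groupoid_functions_outside:
  assumes "f \<in> groupoid_functions G" "\<gamma> \<notin> arrows G"
  shows "f \<gamma> = 0"
proof -
  obtain F c where F: "F \<subseteq> compact_bisections G" and f: "f = (\<lambda>\<gamma>. \<Sum>U\<in>F. c U * indicator U \<gamma>)"
    using assms(1) by (auto simp: groupoid_functions_def)
  have "\<gamma> \<notin> U" if "U \<in> F" for U
    using that F compact_bisectionD(2) assms(2) by blast
  then show ?thesis
    by (simp add: f)
qed

text \<open>A bisection meets each range fibre in at most one arrow, and \<open>f\<close> is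
  supported on finitely many bisections.\<close>

lemma finite_support_ran_fibre:
  assumes "f \<in> groupoid_functions G"
  shows "finite {\<alpha> \<in> ran_fibre x. f \<alpha> \<noteq> 0}"
proof -
  obtain F c where F: "finite F" "F \<subseteq> compact_bisections G"
    and f: "f = (\<lambda>\<gamma>. \<Sum>U\<in>F. c U * indicator U \<gamma>)"
    using assms by (auto simp: groupoid_functions_def)
  have "finite (ran_map G -` {x} \<inter> U)" if "U \<in> F" for U
    using that F(2) compact_bisectionD(4) by (intro finite_vimage_IntI) auto
  moreover have "\<exists>U\<in>F. \<alpha> \<in> U" if "f \<alpha> \<noteq> 0" for \<alpha>
  proof (rule ccontr)
    assume "\<not> ?thesis"
    then have "f \<alpha> = 0"
      unfolding f by (intro sum.neutral) (auto simp: indicator_def)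
    with that show False by simp
  qed
  then have "{\<alpha> \<in> ran_fibre x. f \<alpha> \<noteq> 0} \<subseteq> (\<Union>U\<in>F. ran_map G -` {x} \<inter> U)"
    by auto
  ultimately show ?thesis
    using F(1) by (meson finite_UN_I finite_subset)
qed

text \<open>Injectivity of the range map leaves at most one nonzero term, present exactly when
  \<open>x\<close> is the range of an element of \<open>W\<close>.\<close>

lemma has_sum_indicator_ran_fibre:
  assumes "W \<subseteq> arrows G" "inj_on (ran_map G) W"
  shows "((indicator W :: 'a \<Rightarrow> complex) has_sum indicator (ran_map G ` W) x) (ran_fibre x)"
proof (cases "x \<in> ran_map G ` W")
  case True
  then obtain w where w: "w \<in> W" "x = ran_map G w" by auto
  show ?thesis
  proof (rule has_sum_finite_neutralI[of "{w}"])
    show "indicator W \<alpha> = (0 :: complex)" if "\<alpha> \<in> ran_fibre x - {w}" for \<alpha>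
      using that w assms(2) by (auto simp: indicator_def dest: inj_onD)
  qed (use assms(1) w True in auto)
next
  case False
  then show ?thesis
    by (auto intro!: has_sum_0 simp: indicator_def)
qed

text \<open>A product equal to a unit determines its right factor as the inverse of the left one, so
  the index set is a copy of the fibre. Reindexing an \<open>infsum\<close> along an injection is
  unconditional, hence \<open>f\<close> and \<open>g\<close> are arbitrary.\<close>

lemma convolution_unit:
  assumes "x \<in> units G"
  shows "convolution G f g x = (\<Sum>\<^sub>\<infinity>\<alpha>\<in>ran_fibre x. f \<alpha> * g (ginv G \<alpha>))"
proof -
  have "\<beta> = ginv G \<alpha>" if "(\<alpha>, \<beta>) \<in> comp_pairs G" "gmult G \<alpha> \<beta> = x" for \<alpha> \<beta>
  proof -
    have \<alpha>: "\<alpha> \<in> arrows G"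
      using comp_arrows that by blast
    have "dom_map G (ginv G \<alpha>) = x"
      using that ran_comp assms \<alpha> by (metis dom_inv unit_ran)
    then show ?thesis
      using inv_cancel_left that mult_dom \<alpha> inv_closed by metis
  qed
  moreover have "ran_map G \<alpha> = x" if "(\<alpha>, \<beta>) \<in> comp_pairs G" "gmult G \<alpha> \<beta> = x" for \<alpha> \<beta>
    using that ran_comp assms by (metis unit_ran)
  ultimately have pairs: "{(\<alpha>, \<beta>) \<in> comp_pairs G. gmult G \<alpha> \<beta> = x} = (\<lambda>\<alpha>. (\<alpha>, ginv G \<alpha>)) ` ran_fibre x"
    using comp_inv comp_arrows by (auto simp: image_iff ran_map_def)
  have "inj_on (\<lambda>\<alpha>. (\<alpha>, ginv G \<alpha>)) (ran_fibre x)"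
    by (auto intro: inj_onI)
  then show ?thesis
    unfolding convolution_def pairs by (simp add: infsum_reindex o_def)
qed

text \<open>Each pair of indicators contributes the indicator of
  \<open>U \<inter> set_inv G V\<close>, on which the range map is injective. Stating the sums with
  \<open>has_sum\<close> carries convergence through the finite combinations, and
  \<open>infsum\<close> appears only at the end.\<close>

lemma convolution_unit_indicators:
  assumes "x \<in> units G"
    and F: "finite F" "F \<subseteq> bisections G" and F': "F' \<subseteq> bisections G" "finite F'"
  shows "convolution G (\<lambda>\<gamma>. \<Sum>U\<in>F. c U * indicator U \<gamma>) (\<lambda>\<gamma>. \<Sum>V\<in>F'. d V * indicator V \<gamma>) x
    = (\<Sum>U\<in>F. \<Sum>V\<in>F'. c U * d V * indicator (ran_map G ` (U \<inter> set_inv G V)) x)"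
proof -
  have "((\<lambda>\<alpha>. \<Sum>U\<in>F. \<Sum>V\<in>F'. c U * d V * indicator (U \<inter> set_inv G V) \<alpha>) has_sum
      (\<Sum>U\<in>F. \<Sum>V\<in>F'. c U * d V * indicator (ran_map G ` (U \<inter> set_inv G V)) x)) (ran_fibre x)"
    using F F' bisection_subset
    by (intro has_sum_finite_sum has_sum_cmult_right has_sum_indicator_ran_fibre)
      (auto simp: bisections_def intro: inj_on_Int)
  moreover have "(\<Sum>U\<in>F. c U * indicator U \<alpha>) * (\<Sum>V\<in>F'. d V * indicator V (ginv G \<alpha>))
      = (\<Sum>U\<in>F. \<Sum>V\<in>F'. c U * d V * indicator (U \<inter> set_inv G V) \<alpha>)"
    if "\<alpha> \<in> ran_fibre x" for \<alpha>
  proof -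
    have "indicator U \<alpha> * indicator V (ginv G \<alpha>) = (indicator (U \<inter> set_inv G V) \<alpha> :: complex)"
      if "V \<in> F'" for U V
      using that F'(1) \<open>\<alpha> \<in> ran_fibre x\<close> bisection_subset[of V]
      by (auto simp: set_inv_vimage indicator_def)
    then show ?thesis
      unfolding sum_product by (intro sum.cong refl) (simp add: mult.assoc mult.left_commute)
  qed
  ultimately have "((\<lambda>\<alpha>. (\<Sum>U\<in>F. c U * indicator U \<alpha>) * (\<Sum>V\<in>F'. d V * indicator V (ginv G \<alpha>)))
      has_sum (\<Sum>U\<in>F. \<Sum>V\<in>F'. c U * d V * indicator (ran_map G ` (U \<inter> set_inv G V)) x)) (ran_fibre x)"
    by (rule has_sum_cong[THEN iffD2, rotated])
  then show ?thesis
    unfolding convolution_unit[OF assms(1)] by (rule infsumI)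
qed

text \<open>Only finite support on the fibre is assumed of \<open>f\<close>, so that the formula
  also applies to \<open>f\<close> convolved with an indicator without showing that this lies in
  \<open>groupoid_functions G\<close>.\<close>

lemma convolution_involution_unit:
  assumes "x \<in> units G" "finite {\<alpha> \<in> ran_fibre x. f \<alpha> \<noteq> 0}"
  shows "convolution G f (involution G f) x
    = of_real (\<Sum>\<alpha>\<in>{\<alpha> \<in> ran_fibre x. f \<alpha> \<noteq> 0}. (cmod (f \<alpha>))\<^sup>2)"
proof -
  have "convolution G f (involution G f) x = (\<Sum>\<^sub>\<infinity>\<alpha>\<in>ran_fibre x. of_real ((cmod (f \<alpha>))\<^sup>2))"
    unfolding convolution_unit[OF assms(1)] involution_def
    by (rule infsum_cong) (simp add: inv_closed inv_inv flip: complex_norm_square)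
  also have "\<dots> = (\<Sum>\<^sub>\<infinity>\<alpha>\<in>{\<alpha> \<in> ran_fibre x. f \<alpha> \<noteq> 0}. of_real ((cmod (f \<alpha>))\<^sup>2))"
    by (rule infsum_cong_neutral) auto
  finally show ?thesis
    using assms(2) by simp
qed

lemma convolution_indicator_eq_0:
  assumes "\<And>\<beta>. \<beta> \<in> U \<Longrightarrow> dom_map G \<beta> \<noteq> dom_map G \<gamma>"
  shows "convolution G f (indicator U) \<gamma> = 0"
proof -
  have "\<beta> \<notin> U" if "(\<alpha>, \<beta>) \<in> comp_pairs G" "gmult G \<alpha> \<beta> = \<gamma>" for \<alpha> \<beta>
    using assms dom_mult that by metis
  then show ?thesis
    unfolding convolution_def by (intro infsum_0) auto
qed

text \<open>In any factorization of \<open>\<gamma>\<close>, the right factor has the source of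
  \<open>\<gamma>\<close>; within \<open>U\<close> this forces it to be \<open>\<beta>\<close>, and
  then the left factor is determined by cancellation. The convolution sum thus has a single relevant
  term.\<close>

lemma convolution_indicator:
  assumes U: "U \<in> bisections G" and "\<gamma> \<in> arrows G" "\<beta> \<in> U" "dom_map G \<beta> = dom_map G \<gamma>"
  shows "(gmult G \<gamma> (ginv G \<beta>), \<beta>) \<in> comp_pairs G" "gmult G (gmult G \<gamma> (ginv G \<beta>)) \<beta> = \<gamma>"
    "convolution G f (indicator U) \<gamma> = f (gmult G \<gamma> (ginv G \<beta>))"
proof -
  have \<beta>: "\<beta> \<in> arrows G"
    using assms bisection_subset by blast
  have \<gamma>\<beta>: "(\<gamma>, ginv G \<beta>) \<in> comp_pairs G"
    using assms \<beta> by (simp add: comp_pairs_iff inv_closed ran_inv)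
  then show comp: "(gmult G \<gamma> (ginv G \<beta>), \<beta>) \<in> comp_pairs G"
    using \<beta> by (simp add: comp_pairs_iff[of _ \<beta>] mult_closed dom_mult dom_inv)
  show mult: "gmult G (gmult G \<gamma> (ginv G \<beta>)) \<beta> = \<gamma>"
    using inv_cancel_right[OF \<gamma>\<beta>] \<beta> by (simp add: inv_inv)
  have uniq: "\<beta>' = \<beta> \<and> \<alpha>' = gmult G \<gamma> (ginv G \<beta>)"
    if "(\<alpha>', \<beta>') \<in> comp_pairs G" "gmult G \<alpha>' \<beta>' = \<gamma>" "\<beta>' \<in> U" for \<alpha>' \<beta>'
  proof -
    have "dom_map G \<beta>' = dom_map G \<beta>"
      using dom_mult[OF that(1)] that(2) assms(4) by simp
    then have "\<beta>' = \<beta>"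
      using that(3) assms(3) U by (auto simp: bisections_def dest: inj_onD)
    then show ?thesis
      using that(2) inv_cancel_right[OF that(1)] by simp
  qed
  have "convolution G f (indicator U) \<gamma>
      = (\<Sum>\<^sub>\<infinity>(\<alpha>, \<beta>)\<in>{(gmult G \<gamma> (ginv G \<beta>), \<beta>)}. f \<alpha> * indicator U \<beta>)"
    unfolding convolution_def
  proof (rule infsum_cong_neutral)
    fix p assume p: "p \<in> {(\<alpha>, \<beta>) \<in> comp_pairs G. gmult G \<alpha> \<beta> = \<gamma>} - {(gmult G \<gamma> (ginv G \<beta>), \<beta>)}"
    have "snd p \<notin> U"
    proof
      assume "snd p \<in> U"
      then have "snd p = \<beta> \<and> fst p = gmult G \<gamma> (ginv G \<beta>)"
        using p by (intro uniq) auto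
      then show False
        using p by (auto simp: prod_eq_iff)
    qed
    then show "(case p of (\<alpha>, \<beta>) \<Rightarrow> f \<alpha> * indicator U \<beta>) = 0"
      by (simp add: case_prod_beta)
  qed (use comp mult in auto)
  then show "convolution G f (indicator U) \<gamma> = f (gmult G \<gamma> (ginv G \<beta>))"
    using assms(3) by simp
qed

lemma convolution_outside: "\<gamma> \<notin> arrows G \<Longrightarrow> convolution G f g \<gamma> = 0"
  unfolding convolution_def by (rule infsum_0) (auto dest: mult_closed)

text \<open>With \<open>h = f * 1\<^sub>U\<close>, right translation \<open>\<gamma> \<mapsto> \<gamma>\<beta>\<inverse>\<close> by the element \<open>\<beta>\<close> of \<open>U\<close> with the source of
  \<open>\<gamma>\<close> embeds the support of \<open>h\<close> in a fibre into that of \<open>f\<close> and carries \<open>h\<close> to \<open>f\<close>.\<close>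

lemma sum_norm_convolution_indicator_le:
  fixes f :: "'a \<Rightarrow> complex"
  defines "S \<equiv> \<lambda>h x. {\<gamma> \<in> ran_fibre x. h \<gamma> \<noteq> 0}"
  assumes U: "U \<in> bisections G" and fin: "finite (S f x)"
  shows "finite (S (convolution G f (indicator U)) x)"
    and "(\<Sum>\<gamma>\<in>S (convolution G f (indicator U)) x. (cmod (convolution G f (indicator U) \<gamma>))\<^sup>2)
      \<le> (\<Sum>\<alpha>\<in>S f x. (cmod (f \<alpha>))\<^sup>2)"
proof -
  define h where "h = convolution G f (indicator U)"
  have "\<exists>\<beta>\<in>U. dom_map G \<beta> = dom_map G \<gamma>" if "\<gamma> \<in> S h x" for \<gamma>
  proof (rule ccontr)
    assume "\<not> ?thesis"
    then have "h \<gamma> = 0"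
      unfolding h_def by (intro convolution_indicator_eq_0) blast
    then show False
      using that by (simp add: S_def)
  qed
  then have "\<forall>\<gamma>\<in>S h x. \<exists>\<beta>. \<beta> \<in> U \<and> dom_map G \<beta> = dom_map G \<gamma>"
    by blast
  from bchoice[OF this] obtain b
    where b: "\<And>\<gamma>. \<gamma> \<in> S h x \<Longrightarrow> b \<gamma> \<in> U \<and> dom_map G (b \<gamma>) = dom_map G \<gamma>"
    by blast
  define \<phi> where "\<phi> = (\<lambda>\<gamma>. gmult G \<gamma> (ginv G (b \<gamma>)))"
  have \<phi>: "(\<phi> \<gamma>, b \<gamma>) \<in> comp_pairs G" "gmult G (\<phi> \<gamma>) (b \<gamma>) = \<gamma>" "h \<gamma> = f (\<phi> \<gamma>)"
    if "\<gamma> \<in> S h x" for \<gamma>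
  proof -
    have "\<gamma> \<in> arrows G"
      using that by (simp add: S_def)
    note conv = convolution_indicator[OF U this conjunct1[OF b[OF that]] conjunct2[OF b[OF that]]]
    show "(\<phi> \<gamma>, b \<gamma>) \<in> comp_pairs G" "gmult G (\<phi> \<gamma>) (b \<gamma>) = \<gamma>" "h \<gamma> = f (\<phi> \<gamma>)"
      unfolding \<phi>_def h_def by (rule conv)+
  qed
  \<comment> \<open>Since \<open>\<gamma>\<close> is the product of \<open>\<phi> \<gamma>\<close>
    and \<open>b \<gamma>\<close>, it has the same range as \<open>\<phi> \<gamma>\<close>, so
    translation stays in the fibre.\<close>
  have sub: "\<phi> ` S h x \<subseteq> S f x"
  proof
    fix \<alpha> assume "\<alpha> \<in> \<phi> ` S h x"
    then obtain \<gamma> where \<gamma>: "\<gamma> \<in> S h x" "\<alpha> = \<phi> \<gamma>" by blast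
    then show "\<alpha> \<in> S f x"
      using ran_comp[OF \<phi>(1)[OF \<gamma>(1)]] comp_arrows(1)[OF \<phi>(1)[OF \<gamma>(1)]] \<phi>(2,3)[OF \<gamma>(1)]
      by (simp add: S_def)
  qed
  \<comment> \<open>Here the range map must be injective on \<open>U\<close>: equal translates have
    equal sources, which are the ranges of the two elements of \<open>U\<close>, so these elements
    agree and the original arrows are recovered by multiplying back.\<close>
  have inj: "inj_on \<phi> (S h x)"
  proof (rule inj_onI)
    fix \<gamma> \<gamma>' assume *: "\<gamma> \<in> S h x" "\<gamma>' \<in> S h x" "\<phi> \<gamma> = \<phi> \<gamma>'"
    then have "ran_map G (b \<gamma>) = ran_map G (b \<gamma>')"
      using dom_eq_ran[OF \<phi>(1)[OF *(1)]] dom_eq_ran[OF \<phi>(1)[OF *(2)]] by simp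
    moreover have "inj_on (ran_map G) U"
      using U by (simp add: bisections_def)
    ultimately have "b \<gamma> = b \<gamma>'"
      using b[OF *(1)] b[OF *(2)] by (auto dest: inj_onD)
    then show "\<gamma> = \<gamma>'"
      using \<phi>(2)[OF *(1)] \<phi>(2)[OF *(2)] *(3) by metis
  qed
  show "finite (S (convolution G f (indicator U)) x)"
    using finite_imageD[OF finite_subset[OF sub fin] inj] by (simp add: h_def)
  have "(\<Sum>\<gamma>\<in>S h x. (cmod (h \<gamma>))\<^sup>2) = (\<Sum>\<alpha>\<in>\<phi> ` S h x. (cmod (f \<alpha>))\<^sup>2)"
    unfolding sum.reindex[OF inj] o_def by (intro sum.cong refl) (simp add: \<phi>(3))
  also have "\<dots> \<le> (\<Sum>\<alpha>\<in>S f x. (cmod (f \<alpha>))\<^sup>2)"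
    by (rule sum_mono2[OF fin sub]) simp
  finally show "(\<Sum>\<gamma>\<in>S (convolution G f (indicator U)) x. (cmod (convolution G f (indicator U) \<gamma>))\<^sup>2)
      \<le> (\<Sum>\<alpha>\<in>S f x. (cmod (f \<alpha>))\<^sup>2)"
    by (simp add: h_def)
qed

end

section \<open>Involution and identity of the groupoid algebra\<close>

context topological_groupoid
begin

text \<open>The involution sends the indicator of \<open>U\<close> to that of
  \<open>set_inv G U\<close> and conjugates coefficients. As \<open>set_inv G\<close> undoes itself
  on \<open>F\<close>, the coefficient attached to \<open>V\<close> is read off at
  \<open>set_inv G V\<close>.\<close>

lemma involution_groupoid_functions:
  assumes "f \<in> groupoid_functions G"
  shows "involution G f \<in> groupoid_functions G"
proof -
  obtain F c where F: "finite F" "F \<subseteq> compact_bisections G"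
    and f: "f = (\<lambda>\<gamma>. \<Sum>U\<in>F. c U * indicator U \<gamma>)"
    using assms by (auto simp: groupoid_functions_def)
  have inv: "set_inv G (set_inv G U) = U" if "U \<in> F" for U
    using that F(2) compact_bisectionD(2) set_inv_set_inv by blast
  have ind: "indicator (set_inv G U) \<gamma> = (if \<gamma> \<in> arrows G then indicator U (ginv G \<gamma>) else 0 :: complex)"
    if "U \<in> F" for U \<gamma>
    using that F(2) compact_bisectionD(2)[of U] by (auto simp: set_inv_vimage indicator_def)
  have "involution G f \<gamma> = (\<Sum>V\<in>set_inv G ` F. cnj (c (set_inv G V)) * indicator V \<gamma>)" for \<gamma>
  proof -
    have "(\<Sum>V\<in>set_inv G ` F. cnj (c (set_inv G V)) * indicator V \<gamma>)
        = (\<Sum>U\<in>F. cnj (c U) * indicator (set_inv G U) \<gamma>)"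
      using inv by (subst sum.reindex) (auto intro!: inj_on_inverseI[of _ "set_inv G"] sum.cong)
    also have "\<dots> = involution G f \<gamma>"
    proof (cases "\<gamma> \<in> arrows G")
      case True
      have "involution G f \<gamma> = (\<Sum>U\<in>F. cnj (c U) * cnj (indicator U (ginv G \<gamma>)))"
        using True by (simp add: involution_def f)
      also have "\<dots> = (\<Sum>U\<in>F. cnj (c U) * indicator (set_inv G U) \<gamma>)"
      proof (rule sum.cong[OF refl])
        show "cnj (c U) * cnj (indicator U (ginv G \<gamma>)) = cnj (c U) * indicator (set_inv G U) \<gamma>"
          if "U \<in> F" for U
          using ind[OF that, of \<gamma>] True by (cases "ginv G \<gamma> \<in> U") simp_all
      qed
      finally show ?thesis ..
    next
      case False
      then have "(indicator (set_inv G U) \<gamma> :: complex) = 0" if "U \<in> F" for U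
        using ind[OF that, of \<gamma>] by simp
      with False show ?thesis
        by (simp add: involution_def)
    qed
    finally show ?thesis ..
  qed
  then have "involution G f = (\<lambda>\<gamma>. \<Sum>V\<in>set_inv G ` F. cnj (c (set_inv G V)) * indicator V \<gamma>)"
    by (rule ext)
  moreover have "finite (set_inv G ` F)" "set_inv G ` F \<subseteq> compact_bisections G"
    using F set_inv_compact_bisections by auto
  ultimately show ?thesis
    unfolding groupoid_functions_def
    by (intro CollectI exI[of _ "set_inv G ` F"] exI[of _ "\<lambda>V. cnj (c (set_inv G V))"] conjI)
qed

end

context etale_groupoid
begin

lemma units_identity:
  assumes "compact_space (unit_space G)"
  shows "is_identity (groupoid_algebra G) (indicator (units G))"
proof -
  have "compactin (gtop G) (units G)"
    using assms units_subset by (simp add: compactin_subspace unit_space_def arrows_def)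
  then have "units G \<in> compact_bisections G"
    using units_bisection by (simp add: compact_bisections_def)
  then have "indicator (units G) \<in> groupoid_functions G"
    unfolding groupoid_functions_def
    by (intro CollectI exI[of _ "{units G}"] exI[of _ "\<lambda>_. 1"]) auto
  moreover have "convolution G f (indicator (units G)) = f" "convolution G (indicator (units G)) f = f"
    if f: "f \<in> groupoid_functions G" for f
  proof -
    have "convolution G f (indicator (units G)) \<gamma> = f \<gamma> \<and> convolution G (indicator (units G)) f \<gamma> = f \<gamma>" for \<gamma>
    proof (cases "\<gamma> \<in> arrows G")
      case True
      \<comment> \<open>The unit with the source of \<open>\<gamma>\<close> is that source itself,
        and translating by its inverse fixes \<open>\<gamma>\<close>.\<close>
      have right: "convolution G f (indicator (units G)) \<gamma> = f \<gamma>"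
        using convolution_indicator(3)[OF units_bisection True dom_in_units[OF True] dom_dom[OF True]] True
        by (simp add: unit_inv dom_in_units mult_dom)
      \<comment> \<open>A unit on the left can only be the range of the right factor, which leaves
        one factorization.\<close>
      have "\<alpha> = ran_map G \<gamma> \<and> \<beta> = \<gamma>"
        if "(\<alpha>, \<beta>) \<in> comp_pairs G" "gmult G \<alpha> \<beta> = \<gamma>" "\<alpha> \<in> units G" for \<alpha> \<beta>
      proof -
        have "\<alpha> = ran_map G \<beta>"
          using dom_eq_ran[OF that(1)] unit_dom[OF that(3)] by simp
        then show ?thesis
          using ran_mult comp_arrows(2)[OF that(1)] that(2) by simp
      qed
      moreover have "(ran_map G \<gamma>, \<gamma>) \<in> comp_pairs G"
        using True ran_in_units[OF True] units_subset by (auto simp: comp_pairs_iff unit_dom)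
      ultimately have pairs:
        "{(\<alpha>, \<beta>) \<in> comp_pairs G. gmult G \<alpha> \<beta> = \<gamma>} \<inter> units G \<times> UNIV = {(ran_map G \<gamma>, \<gamma>)}"
        using ran_mult[OF True] ran_in_units[OF True] by blast
      have "convolution G (indicator (units G)) f \<gamma>
          = (\<Sum>\<^sub>\<infinity>(\<alpha>, \<beta>)\<in>{(\<alpha>, \<beta>) \<in> comp_pairs G. gmult G \<alpha> \<beta> = \<gamma>} \<inter> units G \<times> UNIV.
              indicator (units G) \<alpha> * f \<beta>)"
        unfolding convolution_def by (rule infsum_cong_neutral) (auto simp: indicator_def)
      also have "\<dots> = f \<gamma>"
        unfolding pairs using ran_in_units[OF True] by simp
      finally show ?thesis
        using right by simp
    next
      case False
      then show ?thesis
        using f by (simp add: convolution_outside groupoid_functions_outside)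
    qed
    then show "convolution G f (indicator (units G)) = f" "convolution G (indicator (units G)) f = f"
      by auto
  qed
  ultimately show ?thesis
    by (simp add: is_identity_def groupoid_algebra_def)
qed

end

section \<open>Integration against an invariant measure\<close>

locale etale_groupoid_measure = etale_groupoid +
  fixes \<mu> :: "'a measure"
  assumes invariant: "invariant_measure G \<mu>"
begin

lemma sets_invariant_measure: "sets \<mu> = sigma_sets (units G) {U. openin (unit_space G) U}"
proof -
  have "{U. openin (unit_space G) U} \<subseteq> Pow (units G)"
    using openin_subset[of "unit_space G"] by (auto simp: topspace_unit_space)
  then show ?thesis
    using invariant
    by (simp add: invariant_measure_def radon_measure_def borel_of_def topspace_unit_space)
qed

lemma space_invariant_measure: "space \<mu> = units G"
proof -
  have "space \<mu> = space (borel_of (unit_space G))"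
    using invariant sets_eq_imp_space_eq
    by (auto simp: invariant_measure_def radon_measure_def)
  moreover have "{U. openin (unit_space G) U} \<subseteq> Pow (units G)"
    using openin_subset[of "unit_space G"] by (auto simp: topspace_unit_space)
  ultimately show ?thesis
    by (simp add: borel_of_def topspace_unit_space)
qed

text \<open>Openness gives measurability, and the compact set containing \<open>A\<close> gives
  finite measure. Compactness of \<open>A\<close> cannot be asked for: when \<open>G\<close> is not
  Hausdorff, intersecting a compact bisection with another one or with the unit space may destroy
  it.\<close>

lemma has_bochner_integral_indicator_open:
  assumes "openin (unit_space G) A" "A \<subseteq> ran_map G ` U" "U \<in> compact_bisections G"
  shows "has_bochner_integral \<mu> (indicator A) (complex_of_real (measure \<mu> A))"
proof -
  have sets: "A \<in> sets \<mu>" "ran_map G ` U \<in> sets \<mu>"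
    using assms(1,3) openin_ran compact_bisectionD(3) by (auto simp: sets_invariant_measure)
  have "emeasure \<mu> A \<le> emeasure \<mu> (ran_map G ` U)"
    using assms(2) sets by (intro emeasure_mono)
  also have "\<dots> < \<infinity>"
    using compact_ran[OF assms(3)] invariant
    by (auto simp: invariant_measure_def radon_measure_def)
  finally have "has_bochner_integral \<mu> (\<lambda>x. indicator A x *\<^sub>R (1 :: complex)) (measure \<mu> A *\<^sub>R 1)"
    by (intro has_bochner_integral_indicator sets)
  moreover have "(\<lambda>x. indicator A x *\<^sub>R (1 :: complex)) = indicator A"
    by (auto simp: indicator_def)
  ultimately show ?thesis
    by (simp add: of_real_def)
qed

text \<open>On the space of \<open>\<mu>\<close> the indicator of \<open>U\<close> agrees with that
  of \<open>U \<inter> units G\<close>, and this set lies in the range of \<open>U\<close> because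
  units are their own ranges.\<close>

lemma integrable_groupoid_function:
  assumes "f \<in> groupoid_functions G"
  shows "integrable \<mu> f"
proof -
  obtain F c where F: "finite F" "F \<subseteq> compact_bisections G"
    and f: "f = (\<lambda>\<gamma>. \<Sum>U\<in>F. c U * indicator U \<gamma>)"
    using assms by (auto simp: groupoid_functions_def)
  have "integrable \<mu> (indicator U :: 'a \<Rightarrow> complex)" if "U \<in> F" for U
  proof -
    have U: "U \<in> compact_bisections G"
      using that F by blast
    have "openin (unit_space G) (U \<inter> units G)"
      using compact_bisectionD(3)[OF U] by (auto simp: unit_space_def openin_subtopology)
    moreover have "U \<inter> units G \<subseteq> ran_map G ` U"
      by (force simp: unit_ran)
    ultimately have "integrable \<mu> (indicator (U \<inter> units G) :: 'a \<Rightarrow> complex)"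
      using has_bochner_integral_indicator_open U has_bochner_integral_iff by blast
    then show ?thesis
      by (rule Bochner_Integration.integrable_cong[THEN iffD1, rotated -1])
        (auto simp: space_invariant_measure indicator_def)
  qed
  then show ?thesis
    unfolding f by (intro Bochner_Integration.integrable_sum integrable_mult_right)
qed

lemma has_bochner_integral_convolution:
  assumes F: "finite F" "F \<subseteq> compact_bisections G" and F': "finite F'" "F' \<subseteq> compact_bisections G"
  shows "has_bochner_integral \<mu>
      (convolution G (\<lambda>\<gamma>. \<Sum>U\<in>F. c U * indicator U \<gamma>) (\<lambda>\<gamma>. \<Sum>V\<in>F'. d V * indicator V \<gamma>))
      (\<Sum>U\<in>F. \<Sum>V\<in>F'. c U * d V * of_real (measure \<mu> (ran_map G ` (U \<inter> set_inv G V))))"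
proof -
  have "has_bochner_integral \<mu>
      (\<lambda>x. \<Sum>U\<in>F. \<Sum>V\<in>F'. c U * d V * indicator (ran_map G ` (U \<inter> set_inv G V)) x)
      (\<Sum>U\<in>F. \<Sum>V\<in>F'. c U * d V * of_real (measure \<mu> (ran_map G ` (U \<inter> set_inv G V))))"
  proof (intro has_bochner_integral_sum has_bochner_integral_mult_right)
    fix U V assume "U \<in> F" "V \<in> F'"
    then have UV: "U \<in> compact_bisections G" "V \<in> compact_bisections G"
      using F F' by auto
    then have "openin (gtop G) (U \<inter> set_inv G V)"
      by (intro openin_Int openin_set_inv compact_bisectionD(3))
    then show "has_bochner_integral \<mu> (indicator (ran_map G ` (U \<inter> set_inv G V)))
        (complex_of_real (measure \<mu> (ran_map G ` (U \<inter> set_inv G V))))"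
      by (intro has_bochner_integral_indicator_open[OF _ _ UV(1)] openin_ran) auto
  qed
  moreover have "F \<subseteq> bisections G" "F' \<subseteq> bisections G"
    using F F' by (auto simp: compact_bisections_def)
  \<comment> \<open>The pointwise formula is available at units only, and these make up the whole
    space of \<open>\<mu>\<close>.\<close>
  ultimately show ?thesis
    using convolution_unit_indicators[OF _ F(1) _ _ F'(1)]
    by (subst has_bochner_integral_cong[OF refl _ refl]) (simp_all only: space_invariant_measure)
qed

lemma integrable_convolution:
  assumes "f \<in> groupoid_functions G" "g \<in> groupoid_functions G"
  shows "integrable \<mu> (convolution G f g)"
  using assms has_bochner_integral_convolution
  by (auto simp: groupoid_functions_def has_bochner_integral_iff)

text \<open>The two intersections are inverse to each other, so the range of one is the source of
  the other. The set \<open>?W\<close> is an open bisection that may fail to be compact, so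
  invariance is applied to it as a member of \<open>bisections G\<close>.\<close>

lemma measure_ran_swap:
  assumes "U \<in> compact_bisections G" "V \<in> compact_bisections G"
  shows "measure \<mu> (ran_map G ` (U \<inter> set_inv G V)) = measure \<mu> (ran_map G ` (V \<inter> set_inv G U))"
proof -
  let ?W = "U \<inter> set_inv G V"
  have W: "?W \<in> bisections G"
    using assms compact_bisectionD(1) bisections_Int set_inv_bisections by auto
  have UV: "U \<subseteq> arrows G" "V \<subseteq> arrows G"
    using assms compact_bisectionD(2) by auto
  have "V \<inter> set_inv G U = set_inv G ?W"
    using UV inv_inv inv_closed by (auto simp: set_inv_vimage le_infI1)
  then have "ran_map G ` (V \<inter> set_inv G U) = dom_map G ` ?W"
    using UV by (simp add: ran_set_inv le_infI1)
  moreover have "emeasure \<mu> (dom_map G ` ?W) = emeasure \<mu> (ran_map G ` ?W)"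
    using invariant W unfolding invariant_measure_def
    by (metis bisection_inv_mult bisection_mult_inv)
  ultimately show ?thesis
    by (simp add: measure_def)
qed

lemma measure_functional_convolution_commute:
  assumes "f \<in> groupoid_functions G" "g \<in> groupoid_functions G"
  shows "measure_functional \<mu> (convolution G f g) = measure_functional \<mu> (convolution G g f)"
proof -
  obtain F c where F: "finite F" "F \<subseteq> compact_bisections G"
    and f: "f = (\<lambda>\<gamma>. \<Sum>U\<in>F. c U * indicator U \<gamma>)"
    using assms(1) by (auto simp: groupoid_functions_def)
  obtain F' d where F': "finite F'" "F' \<subseteq> compact_bisections G"
    and g: "g = (\<lambda>\<gamma>. \<Sum>V\<in>F'. d V * indicator V \<gamma>)"
    using assms(2) by (auto simp: groupoid_functions_def)
  have "measure_functional \<mu> (convolution G f g)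
      = (\<Sum>U\<in>F. \<Sum>V\<in>F'. c U * d V * of_real (measure \<mu> (ran_map G ` (U \<inter> set_inv G V))))"
    unfolding measure_functional_def f g
    by (rule has_bochner_integral_integral_eq[OF has_bochner_integral_convolution[OF F F']])
  also have "\<dots> = (\<Sum>V\<in>F'. \<Sum>U\<in>F. c U * d V * of_real (measure \<mu> (ran_map G ` (U \<inter> set_inv G V))))"
    by (rule sum.swap)
  also have "\<dots> = (\<Sum>V\<in>F'. \<Sum>U\<in>F. d V * c U * of_real (measure \<mu> (ran_map G ` (V \<inter> set_inv G U))))"
    using F F' measure_ran_swap by (intro sum.cong refl) (simp add: subset_iff)
  also have "\<dots> = measure_functional \<mu> (convolution G g f)"
    unfolding measure_functional_def f g
    by (rule has_bochner_integral_integral_eq[OF has_bochner_integral_convolution[OF F' F], symmetric])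
  finally show ?thesis .
qed

lemma measure_functional_convolution_involution:
  assumes "\<And>x. x \<in> units G \<Longrightarrow> finite {\<alpha> \<in> ran_fibre x. f \<alpha> \<noteq> 0}"
  shows "measure_functional \<mu> (convolution G f (involution G f))
    = of_real (\<integral>x. (\<Sum>\<alpha>\<in>{\<alpha> \<in> ran_fibre x. f \<alpha> \<noteq> 0}. (cmod (f \<alpha>))\<^sup>2) \<partial>\<mu>)"
proof -
  have "measure_functional \<mu> (convolution G f (involution G f))
    = (\<integral>x. complex_of_real (\<Sum>\<alpha>\<in>{\<alpha> \<in> ran_fibre x. f \<alpha> \<noteq> 0}. (cmod (f \<alpha>))\<^sup>2) \<partial>\<mu>)"
    unfolding measure_functional_def
    using assms by (intro Bochner_Integration.integral_cong refl)
      (simp add: space_invariant_measure convolution_involution_unit)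
  then show ?thesis
    by (simp only: integral_complex_of_real)
qed

section \<open>The trace axioms, contractivity and normalization\<close>

lemma is_trace_measure_functional: "is_trace (groupoid_algebra G) (measure_functional \<mu>)"
proof -
  have "measure_functional \<mu> (\<lambda>\<gamma>. f \<gamma> + g \<gamma>) = measure_functional \<mu> f + measure_functional \<mu> g"
    if "f \<in> groupoid_functions G" "g \<in> groupoid_functions G" for f g
    using that by (simp add: measure_functional_def integrable_groupoid_function)
  \<comment> \<open>Unlike additivity, scaling and conjugation hold for every \<open>f\<close>,
    because the integral of a function that is not integrable is \<open>0\<close>.\<close>
  moreover have "measure_functional \<mu> (\<lambda>\<gamma>. c * f \<gamma>) = c * measure_functional \<mu> f" for c f
    by (simp add: measure_functional_def)
  moreover have "measure_functional \<mu> (involution G f) = cnj (measure_functional \<mu> f)" for f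
  proof -
    \<comment> \<open>A unit is its own inverse, so at units the involution is plain
      conjugation.\<close>
    have "measure_functional \<mu> (involution G f) = (\<integral>x. cnj (f x) \<partial>\<mu>)"
      unfolding measure_functional_def using units_subset
      by (intro Bochner_Integration.integral_cong refl)
        (auto simp: space_invariant_measure involution_def unit_inv)
    then show ?thesis
      by (simp add: measure_functional_def)
  qed
  moreover have "0 \<le> measure_functional \<mu> (convolution G f (involution G f))"
    if "f \<in> groupoid_functions G" for f
    unfolding measure_functional_convolution_involution[OF finite_support_ran_fibre[OF that]]
    by (simp add: sum_nonneg less_eq_complex_def)
  ultimately show ?thesis
    by (simp add: is_trace_def groupoid_algebra_def measure_functional_convolution_commute)
qed

text \<open>Contractivity holds already for the integrands.  The larger one is integrable, so that of the
  smaller one need not be discussed: its integral would be \<open>0\<close> otherwise.\<close>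

lemma is_contractive_trace_measure_functional: "is_contractive_trace G (measure_functional \<mu>)"
proof -
  have "measure_functional \<mu> (convolution G (convolution G f (indicator U))
          (involution G (convolution G f (indicator U))))
        \<le> measure_functional \<mu> (convolution G f (involution G f))"
    if f: "f \<in> groupoid_functions G" and U: "U \<in> compact_bisections G" for f U
  proof -
    define N where "N = (\<lambda>h x. \<Sum>\<alpha>\<in>{\<alpha> \<in> ran_fibre x. h \<alpha> \<noteq> 0}. (cmod (h \<alpha>))\<^sup>2)"
    note fin = finite_support_ran_fibre[OF f]
    note le = sum_norm_convolution_indicator_le[OF compact_bisectionD(1)[OF U] fin]
    \<comment> \<open>At units this integrand is the convolution of \<open>f\<close> with its
      involution, a product of two elements of the algebra.\<close>
    have "integrable \<mu> (\<lambda>x. complex_of_real (N f x))"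
      using integrable_convolution[OF f involution_groupoid_functions[OF f]]
      by (rule Bochner_Integration.integrable_cong[THEN iffD1, rotated -1])
        (simp_all only: space_invariant_measure convolution_involution_unit[OF _ fin] N_def)
    then have "integrable \<mu> (N f)"
      by (simp add: complex_of_real_integrable_eq)
    then have "(\<integral>x. N (convolution G f (indicator U)) x \<partial>\<mu>) \<le> (\<integral>x. N f x \<partial>\<mu>)"
      using le(2) by (intro integral_mono') (auto simp: N_def intro: sum_nonneg)
    then show ?thesis
      using measure_functional_convolution_involution[OF fin]
        measure_functional_convolution_involution[OF le(1)]
      by (simp add: N_def less_eq_complex_def)
  qed
  then show ?thesis
    using is_trace_measure_functional by (simp add: is_contractive_trace_def)
qed

lemma is_normalized_trace_measure_functional:
  assumes "compact_space (unit_space G)" "emeasure \<mu> (units G) = 1"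
  shows "is_normalized_trace (groupoid_algebra G) (measure_functional \<mu>)"
proof -
  have "measure_functional \<mu> (indicator (units G)) = (\<integral>x. 1 \<partial>\<mu>)"
    unfolding measure_functional_def
    by (intro Bochner_Integration.integral_cong refl) (simp add: space_invariant_measure)
  also have "\<dots> = 1"
    using assms(2) by (simp add: space_invariant_measure measure_def)
  finally show ?thesis
    using units_identity[OF assms(1)] is_trace_measure_functional
    by (auto simp: is_normalized_trace_def)
qed

end

theorem theorem7p4:
  fixes G :: "'a groupoid_data" and \<mu> :: "'a measure"
  assumes "ample_groupoid G"
    and "invariant_measure G \<mu>"
  shows "(\<forall>f \<in> groupoid_functions G. integrable \<mu> f) \<and>
    is_contractive_trace G (measure_functional \<mu>) \<and>
    (compact_space (unit_space G) \<and> emeasure \<mu> (units G) = 1 \<longrightarrow>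
       is_normalized_trace (groupoid_algebra G) (measure_functional \<mu>))"
proof -
  interpret ample_groupoid G by fact
  interpret etale_groupoid_measure G \<mu> by unfold_locales fact
  show ?thesis
    using integrable_groupoid_function is_contractive_trace_measure_functional
      is_normalized_trace_measure_functional by blast
qed

end
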